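(* Let $n\ge 2$ and let $X\subset \Omega_n$ be a hereditary subshift. Then the topological entropy $h(X)$ is positive if and only if there exists $\omega\in X$ such that the set $\{j\in\mathbb{N}:\omega_j=1\}$ has positive upper Banach density, i.e. $BD^*(\{j\in\mathbb{N}:\omega_j=1\})>0$.
   Context: $\mathbb{N}=\{1,2,\ldots\}$. For $n\ge 2$, $\Lambda_n=\{0,1,\ldots,n-1\}$ has the discrete topology and $\Omega_n=\Lambda_n^{\mathbb{N}}$ the product topology; $\sigma\colon\Omega_n\to\Omega_n$, $(\sigma(\omega))_i=\omega_{i+1}$, is the shift. A subshift is a nonempty closed set $X\subset\Omega_n$ with $\sigma(X)\subset X$. A subshift $X\subset\Omega_n$ is hereditary if whenever $\omega\in X$, $\omega'\in\Omega_n$ and $\omega'_i\le\omega_i$ for all $i\in\mathbb{N}$, then $\omega'\in X$. $\mathcal{L}_k(X)$ is the set of words of length $k$ appearing (as blocks of consecutive symbols) in some element of $X$, and the topological entropy is $h(X)=\lim_{k\to\infty}\frac{1}{k}\log\#\mathcal{L}_k(X)$ (logarithm base 2). For $A\subset\mathbb{N}$, the upper Banach density is $BD^*(A)=\limsup_{n-m\to\infty}\frac{\#(A\cap\{m,m+1,\ldots,n-1\})}{n-m}$. *)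

theory Defs
  imports "HOL-Analysis.Analysis"
begin

text \<open>Positions are the integers \<open>i \<ge> 1\<close>. A one-sided sequence is an extensional function on
  \<open>{1..}\<close> (it takes the value \<^term>\<open>undefined\<close> at 0), so that the library's product topology
  applies directly.\<close>

definition full_shift :: "nat \<Rightarrow> (nat \<Rightarrow> nat) set" where
  "full_shift n = ({1..} \<rightarrow>\<^sub>E {0..<n})"

definition full_shift_topology :: "nat \<Rightarrow> (nat \<Rightarrow> nat) topology" where
  "full_shift_topology n = product_topology (\<lambda>_. discrete_topology {0..<n}) {1..}"

definition shift :: "(nat \<Rightarrow> nat) \<Rightarrow> nat \<Rightarrow> nat" where
  "shift \<omega> = (\<lambda>i\<in>{1..}. \<omega> (i + 1))"

definition subshift :: "nat \<Rightarrow> (nat \<Rightarrow> nat) set \<Rightarrow> bool" where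
  "subshift n X \<longleftrightarrow>
     X \<noteq> {} \<and> X \<subseteq> full_shift n \<and> closedin (full_shift_topology n) X \<and> shift ` X \<subseteq> X"

definition hereditary :: "nat \<Rightarrow> (nat \<Rightarrow> nat) set \<Rightarrow> bool" where
  "hereditary n X \<longleftrightarrow>
     (\<forall>\<omega>\<in>X. \<forall>\<omega>'\<in>full_shift n. (\<forall>i\<ge>1. \<omega>' i \<le> \<omega> i) \<longrightarrow> \<omega>' \<in> X)"

definition language :: "nat \<Rightarrow> (nat \<Rightarrow> nat) set \<Rightarrow> nat list set" where
  "language k X = {map \<omega> [j..<j + k] | \<omega> j. \<omega> \<in> X \<and> 1 \<le> j}"

definition topological_entropy :: "(nat \<Rightarrow> nat) set \<Rightarrow> real" where
  "topological_entropy X = lim (\<lambda>k. 1 / real k * log 2 (real (card (language k X))))"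

text \<open>The filter describes \<open>n - m \<rightarrow> \<infinity>\<close> over pairs \<open>1 \<le> m < n\<close>, with no restriction on how
  \<open>m\<close> itself behaves; the limit superior is therefore uniform in the position \<open>m\<close> of the window.\<close>

definition upper_Banach_density :: "nat set \<Rightarrow> ereal" where
  "upper_Banach_density A =
     Limsup (inf (filtercomap (\<lambda>(m, n). n - m) at_top) (principal {(m, n). 1 \<le> m \<and> m < n}))
       (\<lambda>(m, n). ereal (real (card (A \<inter> {m..<n})) / real (n - m)))"

end

theory Submission
  imports Defs
begin

text \<open>If \<open>\<omega> \<in> X\<close> has \<open>c k\<close> ones in a window of length \<open>k\<close>, deleting any of them stays in \<open>X\<close>, so the
  window carries at least \<open>2\<^sup>c\<^sup>k\<close> words. Conversely, weighting a word by \<open>t\<close> to the number of its nonzero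
  letters (a Chernoff bound) shows that words with few nonzero letters have small exponential growth;
  so positive entropy yields arbitrarily long words with density \<open>\<epsilon>\<close> of nonzero letters. Such a word
  has a starting point from which all prefixes, up to a length tending to infinity, have density at
  least \<open>\<epsilon>/2\<close>. Compactness then gives a single point with this property for all prefixes, and
  lowering its nonzero letters to 1 stays in \<open>X\<close>.\<close>

section \<open>Real sequences: subadditivity and averages\<close>

text \<open>Fekete's lemma. The limit is the infimum of the quotients: division with remainder by an
  \<open>m\<close> whose quotient is nearly minimal bounds \<open>a k / k\<close> from above for all
  large \<open>k\<close>.\<close>

lemma subadditive_quotient_limit:
  fixes a :: "nat \<Rightarrow> real"
  assumes sub: "\<And>m k. a (m + k) \<le> a m + a k" and nonneg: "\<And>k. a k \<ge> 0"
  obtains l where "(\<lambda>k. a k / real k) \<longlonglongrightarrow> l" "\<And>k. k \<ge> 1 \<Longrightarrow> l \<le> a k / real k"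
proof -
  define l where "l = (INF k\<in>{1..}. a k / real k)"
  have bdd: "bdd_below ((\<lambda>k. a k / real k) ` {1..})"
    by (rule bdd_belowI[where m = 0]) (use nonneg in auto)
  have lower: "l \<le> a k / real k" if "k \<ge> 1" for k
    unfolding l_def using that bdd by (intro cINF_lower) auto
  have mult: "a (q * m + r) \<le> real q * a m + a r" for q m r
  proof (induction q)
    case (Suc q)
    have "a (Suc q * m + r) \<le> a m + a (q * m + r)"
      using sub[of m "q * m + r"] by (simp add: add.assoc)
    with Suc show ?case by (simp add: algebra_simps)
  qed auto
  have "(\<lambda>k. a k / real k) \<longlonglongrightarrow> l"
  proof (rule LIMSEQ_I)
    fix e :: real assume "e > 0"
    have "\<exists>m\<in>{1..}. a m / real m < l + e / 2"
      using \<open>e > 0\<close> bdd unfolding l_def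
      by (subst cINF_less_iff[symmetric]) auto
    then obtain m where m: "m \<ge> 1" "a m / real m < l + e / 2" by auto
    \<comment> \<open>A single bound for \<open>a\<close> at every possible remainder modulo
      \<open>m\<close>; its share \<open>C / k\<close> vanishes as \<open>k\<close> grows.\<close>
    define C where "C = (\<Sum>r<m. a r)"
    have C: "a r \<le> C" if "r < m" for r
      unfolding C_def using that nonneg by (intro member_le_sum) auto
    obtain N where N: "real N > 2 * C / e" using reals_Archimedean2 by blast
    have "norm (a k / real k - l) < e" if k: "k \<ge> max 1 N" for k
    proof -
      have "a k \<le> real (k div m) * a m + a (k mod m)"
        using mult[of "k div m" m "k mod m"] by simp
      also have "\<dots> \<le> real k / real m * a m + C"
        using m C nonneg by (intro add_mono mult_right_mono of_nat_div_le_of_nat) auto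
      finally have "a k / real k \<le> (real k / real m * a m + C) / real k"
        using k by (intro divide_right_mono) auto
      also have "\<dots> = a m / real m + C / real k"
        using k m by (simp add: field_simps)
      also have "\<dots> < (l + e / 2) + e / 2"
      proof -
        have "2 * C / e < real k" using N k by linarith
        then have "C / real k < e / 2"
          using \<open>e > 0\<close> k by (simp add: field_simps)
        with m show ?thesis by linarith
      qed
      finally show ?thesis using lower[of k] k by auto
    qed
    then show "\<exists>N. \<forall>k\<ge>N. norm (a k / real k - l) < e" by blast
  qed
  with lower show ?thesis using that by blast
qed

text \<open>Start at a minimum of \<open>f j - c j\<close>: from there on every average is at least \<open>c\<close>, and the
  minimum cannot lie near \<open>N\<close>, because \<open>f\<close> grows with slope at most 1.\<close>

lemma start_of_dense_stretch:
  fixes f :: "nat \<Rightarrow> real" and c :: real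
  assumes "f 0 = 0" and step: "\<And>j. f (Suc j) \<le> f j + 1" and "c \<ge> 0" and "f N \<ge> 2 * c * real N"
  obtains j where "j \<le> N" "real (N - j) \<ge> c * real N"
    "\<And>k. k \<le> N - j \<Longrightarrow> f (j + k) - f j \<ge> c * real k"
proof -
  obtain j where "is_arg_min (\<lambda>i. f i - c * real i) (\<lambda>i. i \<in> {..N}) j"
    using ex_is_arg_min_if_finite[of "{..N}"] by auto
  then have j: "j \<le> N" "\<And>i. i \<le> N \<Longrightarrow> f j - c * real j \<le> f i - c * real i"
    by (auto simp: is_arg_min_linorder)
  have slope: "f (j + k) \<le> f j + real k" for k
  proof (induction k)
    case (Suc k)
    with step[of "j + k"] show ?case by simp
  qed simp
  \<comment> \<open>Comparison with the index 0 gives \<open>f j \<le> c * j \<le> c * N\<close>. As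
    \<open>f N\<close> is at least \<open>2 * c * N\<close>, a rise of at least \<open>c * N\<close>
    remains after \<open>j\<close>, which takes at least that many steps.\<close>
  have "f j - c * real j \<le> 0" using j(2)[of 0] assms(1) by simp
  moreover have "f N \<le> f j + real (N - j)" using slope[of "N - j"] j(1) by simp
  moreover have "c * real j \<le> c * real N" using j(1) \<open>c \<ge> 0\<close> by (simp add: mult_left_mono)
  ultimately have "real (N - j) \<ge> c * real N" using assms(4) by linarith
  moreover have "f (j + k) - f j \<ge> c * real k" if "k \<le> N - j" for k
    using j(2)[of "j + k"] that j(1) by (simp add: algebra_simps)
  ultimately show ?thesis using that j(1) by blast
qed

section \<open>Counting words with few nonzero letters\<close>

definition nonzeros :: "nat list \<Rightarrow> nat" where
  "nonzeros w = length (filter (\<lambda>x. x \<noteq> 0) w)"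

text \<open>The weight is multiplicative over positions. Each position contributes 1 for the letter
  0 and \<open>t\<close> for each of the \<open>n - 1\<close> other letters.\<close>

lemma nonzero_weight_sum:
  fixes t :: real
  assumes "n \<ge> 1"
  shows "(\<Sum>w | set w \<subseteq> {0..<n} \<and> length w = k. t ^ nonzeros w) = (1 + (real n - 1) * t) ^ k"
proof (induction k)
  case 0
  have "{w. set w \<subseteq> {0..<n} \<and> length w = 0} = {[]}" by auto
  then show ?case by (simp add: nonzeros_def)
next
  case (Suc k)
  let ?A = "{w. set w \<subseteq> {0..<n} \<and> length w = k}"
  have letters: "(\<Sum>x\<in>{0..<n}. if x = 0 then 1 else t) = 1 + (real n - 1) * t"
  proof -
    have "{0..<n} = insert 0 {1..<n}" using assms by auto
    then show ?thesis using assms by (simp add: of_nat_diff)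
  qed
  have "(\<Sum>w | set w \<subseteq> {0..<n} \<and> length w = Suc k. t ^ nonzeros w) =
      (\<Sum>(w, x)\<in>?A \<times> {0..<n}. t ^ nonzeros (x # w))"
    unfolding lists_length_Suc_eq
    by (subst sum.reindex) (auto simp: inj_on_def case_prod_unfold)
  also have "\<dots> = (\<Sum>(w, x)\<in>?A \<times> {0..<n}. t ^ nonzeros w * (if x = 0 then 1 else t))"
    by (intro sum.cong) (auto simp: nonzeros_def)
  also have "\<dots> = (\<Sum>w\<in>?A. t ^ nonzeros w) * (\<Sum>x\<in>{0..<n}. if x = 0 then 1 else t)"
    by (simp add: sum_product sum.cartesian_product)
  finally show ?case by (simp only: Suc letters power_Suc2)
qed

text \<open>The Chernoff bound: as \<open>t \<le> 1\<close>, each word of \<open>L\<close> has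
  weight at least \<open>t powr (\<epsilon> * k)\<close>, while all words of length \<open>k\<close>
  together have the weight computed above.\<close>

lemma few_sparse_words:
  fixes t \<epsilon> :: real
  assumes "n \<ge> 1" "0 < t" "t \<le> 1"
    and L: "\<And>w. w \<in> L \<Longrightarrow> set w \<subseteq> {0..<n} \<and> length w = k \<and> real (nonzeros w) \<le> \<epsilon> * real k"
  shows "real (card L) \<le> ((1 + (real n - 1) * t) * t powr (- \<epsilon>)) ^ k"
proof -
  let ?A = "{w. set w \<subseteq> {0..<n} \<and> length w = k}"
  have fin: "finite ?A" by (rule finite_lists_length_eq) auto
  have "real (card L) * t powr (\<epsilon> * real k) = (\<Sum>w\<in>L. t powr (\<epsilon> * real k))" by simp
  also have "\<dots> \<le> (\<Sum>w\<in>L. t ^ nonzeros w)"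
  proof (rule sum_mono)
    fix w assume "w \<in> L"
    then have "t powr (\<epsilon> * real k) \<le> t powr real (nonzeros w)"
      using L assms by (intro powr_mono') auto
    then show "t powr (\<epsilon> * real k) \<le> t ^ nonzeros w"
      using assms by (simp add: powr_realpow)
  qed
  also have "\<dots> \<le> (\<Sum>w\<in>?A. t ^ nonzeros w)"
    using fin L assms by (intro sum_mono2) auto
  also have "\<dots> = (1 + (real n - 1) * t) ^ k" using nonzero_weight_sum assms by blast
  finally have "real (card L) \<le> (1 + (real n - 1) * t) ^ k / t powr (\<epsilon> * real k)"
    using assms by (simp add: pos_le_divide_eq)
  also have "\<dots> = ((1 + (real n - 1) * t) * t powr (- \<epsilon>)) ^ k"
    using assms by (simp add: power_mult_distrib powr_powr divide_inverse flip: powr_minus powr_realpow)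
  finally show ?thesis .
qed

text \<open>The target \<open>2 powr h\<close> is split into two equal factors \<open>s\<close>.
  First \<open>t\<close> is made small enough to keep \<open>1 + b * t\<close> below
  \<open>s\<close>; then \<open>\<epsilon>\<close> is adjusted to this \<open>t\<close> so that the
  other factor equals \<open>s\<close>.\<close>

lemma sparse_parameters:
  fixes h b :: real
  assumes "h > 0" "b \<ge> 0"
  obtains t \<epsilon> :: real where "0 < t" "t \<le> 1" "\<epsilon> > 0" "(1 + b * t) * t powr (- \<epsilon>) < 2 powr h"
proof -
  define s where "s = 2 powr (h / 2)"
  have s: "s > 1" using assms by (simp add: s_def)
  have ss: "s * s = 2 powr h" by (simp add: s_def flip: powr_add)
  \<comment> \<open>The bound 1/2 ensures \<open>log 2 (1 / t) > 0\<close>, needed for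
    \<open>\<epsilon>\<close>; the denominator uses \<open>b + 1\<close> because \<open>b\<close>
    may be 0.\<close>
  define t where "t = min (1/2) ((s - 1) / (2 * (b + 1)))"
  have t: "0 < t" "t < 1" using s assms by (auto simp: t_def)
  have "b * t \<le> (b + 1) * ((s - 1) / (2 * (b + 1)))"
    using assms t by (intro mult_mono) (auto simp: t_def)
  also have "\<dots> = (s - 1) / 2" using assms by (simp add: field_simps)
  also have "\<dots> < s - 1" using s by simp
  finally have 1: "1 + b * t < s" by simp
  define \<epsilon> where "\<epsilon> = h / 2 / log 2 (1 / t)"
  have "log 2 (1 / t) > 0" using t by (subst zero_less_log_cancel_iff) auto
  then have \<epsilon>: "\<epsilon> > 0" "\<epsilon> * log 2 (1 / t) = h / 2" using assms by (auto simp: \<epsilon>_def)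
  have "t powr (- \<epsilon>) = (1 / t) powr \<epsilon>" using t by (simp add: powr_minus powr_divide divide_simps)
  also have "\<dots> = (2 powr log 2 (1 / t)) powr \<epsilon>" using t by simp
  also have "\<dots> = s" unfolding powr_powr s_def mult.commute[of _ \<epsilon>] \<epsilon>(2) ..
  finally have 2: "t powr (- \<epsilon>) = s" .
  have "(1 + b * t) * t powr (- \<epsilon>) < s * s" unfolding 2 using 1 s by simp
  then show ?thesis using that[of t \<epsilon>] t \<epsilon> ss by auto
qed

section \<open>Words and entropy of a subshift\<close>

lemma funpow_shift:
  assumes "\<omega> \<in> extensional {1..}"
  shows "(shift ^^ j) \<omega> = (\<lambda>i\<in>{1..}. \<omega> (i + j))"
proof (induction j)
  case 0
  \<comment> \<open>Extensionality matters here: the restriction sets the value at 0 to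
    \<open>undefined\<close>.\<close>
  show ?case using assms by (simp add: extensional_restrict)
next
  case (Suc j)
  then show ?case by (auto simp: shift_def fun_eq_iff restrict_def)
qed

lemma subshift_funpow_shift:
  assumes "subshift n X" "\<omega> \<in> X"
  shows "(\<lambda>i\<in>{1..}. \<omega> (i + j)) \<in> X"
proof -
  have "(shift ^^ j) \<omega> \<in> X"
    using assms by (induction j) (auto simp: subshift_def)
  moreover have "\<omega> \<in> extensional {1..}"
    using assms by (auto simp: subshift_def full_shift_def PiE_def)
  ultimately show ?thesis by (simp add: funpow_shift)
qed

lemma subshift_less:
  assumes "subshift n X" "\<omega> \<in> X" "i \<ge> 1"
  shows "\<omega> i < n"
  using assms by (fastforce simp: subshift_def full_shift_def PiE_def Pi_def)

lemma language_subset: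
  assumes "subshift n X"
  shows "language k X \<subseteq> {w. set w \<subseteq> {0..<n} \<and> length w = k}"
  using subshift_less[OF assms] by (auto simp: language_def)

lemma finite_language:
  assumes "subshift n X"
  shows "finite (language k X)"
  using language_subset[OF assms] finite_lists_length_eq finite_subset by (metis finite_atLeastLessThan)

lemma card_language_pos:
  assumes "subshift n X"
  shows "card (language k X) \<ge> 1"
proof -
  obtain \<omega> where "\<omega> \<in> X" using assms by (auto simp: subshift_def)
  then have "map \<omega> [1..<1 + k] \<in> language k X" unfolding language_def by blast
  then have "language k X \<noteq> {}" by blast
  with finite_language[OF assms] show ?thesis by (simp add: Suc_le_eq card_gt_0_iff)
qed

text \<open>A word is determined by its first \<open>k\<close> letters and the rest, and both pieces
  occur in the same point.\<close>

lemma card_language_add: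
  assumes "subshift n X"
  shows "card (language (k + l) X) \<le> card (language k X) * card (language l X)"
proof -
  have inj: "inj_on (\<lambda>w. (take k w, drop k w)) (language (k + l) X)"
    by (rule inj_onI) (metis append_take_drop_id prod.inject)
  have "take k w \<in> language k X \<and> drop k w \<in> language l X" if "w \<in> language (k + l) X" for w
  proof -
    obtain \<omega> j where w: "\<omega> \<in> X" "1 \<le> j" "w = map \<omega> [j..<j + (k + l)]"
      using \<open>w \<in> language (k + l) X\<close> unfolding language_def by blast
    have "take k w = map \<omega> [j..<j + k]" "drop k w = map \<omega> [j + k..<j + k + l]"
      by (simp_all add: w(3) take_map drop_map add.assoc)
    moreover have "1 \<le> j + k" using w(2) by simp
    ultimately show ?thesis using w(1,2) unfolding language_def by blast
  qed
  then have "(\<lambda>w. (take k w, drop k w)) ` language (k + l) X \<subseteq> language k X \<times> language l X"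
    by blast
  then have "card (language (k + l) X) \<le> card (language k X \<times> language l X)"
    using finite_language[OF assms] by (intro card_inj_on_le[OF inj]) auto
  then show ?thesis by (simp add: card_cartesian_product)
qed

text \<open>Cutting words makes the logarithmic counts subadditive, so Fekete's lemma applies. The
  second claim yields at least \<open>2 powr (h * k)\<close> words of every length
  \<open>k \<ge> 1\<close>, where \<open>h\<close> is the entropy, and not only
  asymptotically.\<close>

lemma topological_entropy_limit:
  assumes "subshift n X"
  shows "(\<lambda>k. log 2 (real (card (language k X))) / real k) \<longlonglongrightarrow> topological_entropy X"
    and "k \<ge> 1 \<Longrightarrow> topological_entropy X \<le> log 2 (real (card (language k X))) / real k"
proof -
  let ?a = "\<lambda>k. log 2 (real (card (language k X)))"
  note pos = card_language_pos[OF assms]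
  have sub: "?a (k + l) \<le> ?a k + ?a l" for k l
  proof -
    have "?a (k + l) \<le> log 2 (real (card (language k X) * card (language l X)))"
      using card_language_add[OF assms, of k l] pos[of "k + l"]
      by (intro log_mono) (simp_all del: of_nat_mult)
    also have "\<dots> = ?a k + ?a l"
      using pos[of k] pos[of l] by (simp add: log_mult)
    finally show ?thesis .
  qed
  have "?a k \<ge> 0" for k using pos[of k] by simp
  with sub obtain l where l: "(\<lambda>k. ?a k / real k) \<longlonglongrightarrow> l" "\<And>k. k \<ge> 1 \<Longrightarrow> l \<le> ?a k / real k"
    using subadditive_quotient_limit[of ?a] by blast
  have "topological_entropy X = l"
    unfolding topological_entropy_def using limI[OF l(1)] by simp
  with l show "(\<lambda>k. ?a k / real k) \<longlonglongrightarrow> topological_entropy X"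
    "k \<ge> 1 \<Longrightarrow> topological_entropy X \<le> ?a k / real k" by auto
qed

section \<open>Positive upper Banach density\<close>

text \<open>Replaces the filter by windows with start \<open>m\<close> and length \<open>k\<close>:
  positivity means that one fixed density \<open>c\<close> is reached in arbitrarily long windows,
  wherever they lie.\<close>

lemma zero_less_upper_Banach_density_iff:
  "upper_Banach_density A > 0 \<longleftrightarrow>
    (\<exists>c>0. \<forall>N. \<exists>m k. m \<ge> 1 \<and> k \<ge> N \<and> k > 0 \<and> real (card (A \<inter> {m..<m + k})) \<ge> c * real k)"
  (is "_ \<longleftrightarrow> ?R")
proof -
  define F :: "(nat \<times> nat) filter" where
    "F = inf (filtercomap (\<lambda>(m, n). n - m) at_top) (principal {(m, n). 1 \<le> m \<and> m < n})"
  define d where "d = (\<lambda>(m, n). ereal (real (card (A \<inter> {m..<n})) / real (n - m)))"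
  have ud: "upper_Banach_density A = Limsup F d"
    by (simp add: upper_Banach_density_def F_def d_def)
  have ev: "eventually P F \<longleftrightarrow> (\<exists>N. \<forall>m k. 1 \<le> m \<and> k \<ge> N \<and> k > 0 \<longrightarrow> P (m, m + k))" for P
  proof -
    have "eventually P F \<longleftrightarrow> (\<exists>N. \<forall>m n. n - m \<ge> N \<longrightarrow> 1 \<le> m \<and> m < n \<longrightarrow> P (m, n))"
      unfolding F_def eventually_inf_principal eventually_filtercomap_at_top_linorder by auto
    also have "\<dots> \<longleftrightarrow> (\<exists>N. \<forall>m k. 1 \<le> m \<and> k \<ge> N \<and> k > 0 \<longrightarrow> P (m, m + k))"
    proof -
      have "(\<forall>m n. n - m \<ge> N \<longrightarrow> 1 \<le> m \<and> m < n \<longrightarrow> P (m, n)) \<longleftrightarrow>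
          (\<forall>m k. 1 \<le> m \<and> k \<ge> N \<and> k > 0 \<longrightarrow> P (m, m + k))" for N
      proof (intro iffI allI impI)
        fix m n :: nat assume *: "\<forall>m k. 1 \<le> m \<and> k \<ge> N \<and> k > 0 \<longrightarrow> P (m, m + k)" "n - m \<ge> N" "1 \<le> m \<and> m < n"
        from *(1)[THEN spec[of _ m], THEN spec[of _ "n - m"]] *(2,3) show "P (m, n)" by simp
      next
        fix m k :: nat assume *: "\<forall>m n. n - m \<ge> N \<longrightarrow> 1 \<le> m \<and> m < n \<longrightarrow> P (m, n)" "1 \<le> m \<and> k \<ge> N \<and> k > 0"
        from *(1)[THEN spec[of _ m], THEN spec[of _ "m + k"]] *(2) show "P (m, m + k)" by simp
      qed
      then show ?thesis by simp
    qed
    finally show ?thesis .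
  qed
  show ?thesis
  proof
    assume "upper_Banach_density A > 0"
    then obtain c where c: "0 < ereal c" "ereal c < Limsup F d"
      unfolding ud using ereal_dense2 by blast
    \<comment> \<open>Otherwise the limit superior would be at most \<open>c\<close>.\<close>
    have "\<not> eventually (\<lambda>p. d p \<le> ereal c) F"
      using c Limsup_bounded leD by blast
    then have "\<forall>N. \<exists>m k. 1 \<le> m \<and> k \<ge> N \<and> k > 0 \<and> \<not> d (m, m + k) \<le> ereal c"
      unfolding ev by blast
    then have "\<forall>N. \<exists>m k. m \<ge> 1 \<and> k \<ge> N \<and> k > 0 \<and> real (card (A \<inter> {m..<m + k})) \<ge> c * real k"
      by (fastforce simp: d_def not_le pos_less_divide_eq)
    with c show ?R by (intro exI[of _ c]) auto
  next
    assume ?R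
    then obtain c where c: "c > 0"
      "\<And>N. \<exists>m k. m \<ge> 1 \<and> k \<ge> N \<and> k > 0 \<and> real (card (A \<inter> {m..<m + k})) \<ge> c * real k" by blast
    have "Limsup F d \<ge> ereal c"
    proof (rule ccontr)
      assume "\<not> Limsup F d \<ge> ereal c"
      then have "eventually (\<lambda>p. d p < ereal c) F"
        by (intro Limsup_lessD) auto
      then obtain N where "\<And>m k. 1 \<le> m \<and> k \<ge> N \<and> k > 0 \<Longrightarrow> d (m, m + k) < ereal c"
        unfolding ev by blast
      with c(2)[of N] show False by (fastforce simp: d_def pos_divide_less_eq)
    qed
    with c(1) show "upper_Banach_density A > 0"
      unfolding ud by (metis ereal_less(2) less_le_trans)
  qed
qed

section \<open>From dense ones to positive entropy\<close>

text \<open>Every subset of the ones in the window is the set of ones of a 0-1 point below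
  \<open>\<omega>\<close>, which lies in \<open>X\<close> by heredity. Distinct subsets give
  distinct words on the window.\<close>

lemma card_language_ge_power_ones:
  assumes "n \<ge> 2" "subshift n X" "hereditary n X" "\<omega> \<in> X" "m \<ge> 1"
  shows "2 ^ card ({j. 1 \<le> j \<and> \<omega> j = 1} \<inter> {m..<m + k}) \<le> card (language k X)"
proof -
  let ?S = "{j. 1 \<le> j \<and> \<omega> j = 1} \<inter> {m..<m + k}"
  define word :: "nat set \<Rightarrow> nat list"
    where "word B = map (\<lambda>i. of_bool (i \<in> B)) [m..<m + k]" for B
  have inj: "inj_on word (Pow ?S)"
  proof (rule inj_onI)
    fix B C assume *: "B \<in> Pow ?S" "C \<in> Pow ?S" "word B = word C"
    then have "\<forall>i\<in>{m..<m + k}. of_bool (i \<in> B) = (of_bool (i \<in> C) :: nat)"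
      by (simp add: word_def)
    then have "\<forall>i\<in>{m..<m + k}. i \<in> B \<longleftrightarrow> i \<in> C"
      unfolding of_bool_eq_iff .
    with * show "B = C" by blast
  qed
  have "word ` Pow ?S \<subseteq> language k X"
  proof clarify
    fix B assume B: "B \<subseteq> ?S"
    define \<omega>' :: "nat \<Rightarrow> nat" where "\<omega>' = (\<lambda>i\<in>{1..}. of_bool (i \<in> B))"
    have "\<omega>' \<in> full_shift n" using assms(1) by (auto simp: \<omega>'_def full_shift_def)
    moreover have "\<forall>i\<ge>1. \<omega>' i \<le> \<omega> i" using B by (auto simp: \<omega>'_def)
    ultimately have "\<omega>' \<in> X" using assms by (auto simp: hereditary_def)
    moreover have "word B = map \<omega>' [m..<m + k]"
      using assms(5) by (auto simp: word_def \<omega>'_def)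
    ultimately show "word B \<in> language k X" using assms(5) by (auto simp: language_def)
  qed
  then have "card (Pow ?S) \<le> card (language k X)"
    using inj finite_language[OF assms(2)] by (meson card_inj_on_le)
  then show ?thesis by (subst (asm) card_Pow) simp_all
qed

lemma topological_entropy_pos_if_dense_ones:
  assumes "n \<ge> 2" "subshift n X" "hereditary n X" "\<omega> \<in> X"
    and "upper_Banach_density {j. 1 \<le> j \<and> \<omega> j = 1} > 0"
  shows "topological_entropy X > 0"
proof -
  let ?a = "\<lambda>k. log 2 (real (card (language k X)))"
  obtain c where c: "c > 0" and dense: "\<And>N. \<exists>m k. m \<ge> 1 \<and> k \<ge> N \<and> k > 0 \<and>
      real (card ({j. 1 \<le> j \<and> \<omega> j = 1} \<inter> {m..<m + k})) \<ge> c * real k"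
    using assms(5) unfolding zero_less_upper_Banach_density_iff by blast
  \<comment> \<open>The density itself bounds the entropy: a window of length \<open>k\<close> with
    at least \<open>c * k\<close> ones forces at least \<open>2 powr (c * k)\<close> words, for
    arbitrarily large \<open>k\<close>.\<close>
  have "topological_entropy X \<ge> c"
  proof (rule ccontr)
    assume "\<not> topological_entropy X \<ge> c"
    then have "eventually (\<lambda>k. ?a k / real k < c) sequentially"
      using topological_entropy_limit(1)[OF assms(2)] by (intro order_tendstoD(2)) auto
    then obtain N where N: "\<And>k. k \<ge> N \<Longrightarrow> ?a k / real k < c"
      unfolding eventually_sequentially by blast
    obtain m k where mk: "m \<ge> 1" "k \<ge> N" "k > 0"
      and ones: "real (card ({j. 1 \<le> j \<and> \<omega> j = 1} \<inter> {m..<m + k})) \<ge> c * real k"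
      using dense by blast
    let ?s = "card ({j. 1 \<le> j \<and> \<omega> j = 1} \<inter> {m..<m + k})"
    have "real (2 ^ ?s) \<le> real (card (language k X))"
      using card_language_ge_power_ones[OF assms(1-4) mk(1)] of_nat_le_iff by blast
    then have "log 2 (2 ^ ?s) \<le> ?a k" by (intro log_mono) auto
    then have "real ?s \<le> ?a k" by (simp add: log_nat_power)
    with ones N[of k] mk show False by (simp add: pos_divide_less_eq)
  qed
  with c show ?thesis by linarith
qed

section \<open>From positive entropy to dense ones\<close>

text \<open>Real-valued, so that it can serve both as the function \<open>f\<close> of
  \<open>start_of_dense_stretch\<close> and as a continuous function on the full shift.\<close>

definition nonzero_count :: "nat \<Rightarrow> (nat \<Rightarrow> nat) \<Rightarrow> real" where
  "nonzero_count k \<omega> = (\<Sum>i=1..k. of_bool (\<omega> i \<noteq> 0))"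

lemma nonzero_count_shift:
  "nonzero_count k (\<lambda>i\<in>{1..}. \<omega> (i + j)) = nonzero_count (j + k) \<omega> - nonzero_count j \<omega>"
  by (induction k) (simp_all add: nonzero_count_def add.commute)

lemma nonzero_count_eq_nonzeros:
  "nonzero_count k (\<lambda>i\<in>{1..}. \<omega> (i + j)) = real (nonzeros (map \<omega> [Suc j..<Suc j + k]))"
  by (induction k) (simp_all add: nonzero_count_def nonzeros_def add.commute)

text \<open>If all prefixes of length \<open>k\<close> of points of \<open>X\<close> were sparse,
  shift invariance would make all words of length \<open>k\<close> sparse, and the Chernoff bound
  would fall below the number of words guaranteed by the entropy.\<close>

lemma dense_words_if_topological_entropy_pos:
  assumes "n \<ge> 1" "subshift n X" "topological_entropy X > 0"
  obtains \<epsilon> where "\<epsilon> > 0" "\<And>k. k \<ge> 1 \<Longrightarrow> \<exists>\<omega>\<in>X. nonzero_count k \<omega> \<ge> \<epsilon> * real k"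
proof -
  obtain t \<epsilon> :: real where t: "0 < t" "t \<le> 1" and \<epsilon>: "\<epsilon> > 0"
    and less: "(1 + (real n - 1) * t) * t powr (- \<epsilon>) < 2 powr topological_entropy X"
    using sparse_parameters[of "topological_entropy X" "real n - 1"] assms by auto
  have "\<exists>\<omega>\<in>X. nonzero_count k \<omega> \<ge> \<epsilon> * real k" if k: "k \<ge> 1" for k
  proof (rule ccontr)
    assume contra: "\<not> ?thesis"
    have sparse: "real (nonzeros w) \<le> \<epsilon> * real k" if "w \<in> language k X" for w
    proof -
      obtain \<omega> j where w: "\<omega> \<in> X" "j \<ge> 1" "w = map \<omega> [j..<j + k]"
        using \<open>w \<in> language k X\<close> unfolding language_def by blast
      \<comment> \<open>Shifting by \<open>j - 1\<close> moves position \<open>j\<close> to position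
        1, turning the word into a prefix.\<close>
      have "real (nonzeros w) = nonzero_count k (\<lambda>i\<in>{1..}. \<omega> (i + (j - 1)))"
        unfolding nonzero_count_eq_nonzeros using w by simp
      also have "\<dots> \<le> \<epsilon> * real k"
        using contra subshift_funpow_shift[OF assms(2) w(1)] by (meson linear)
      finally show ?thesis .
    qed
    have "real (card (language k X)) \<le> ((1 + (real n - 1) * t) * t powr (- \<epsilon>)) ^ k"
      using sparse language_subset[OF assms(2), of k] assms(1) t by (intro few_sparse_words) blast+
    also have "\<dots> < (2 powr topological_entropy X) ^ k"
      using less assms(1) t k by (intro power_strict_mono) auto
    also have "\<dots> = 2 powr (topological_entropy X * real k)"
      by (simp add: powr_power mult.commute)
    \<comment> \<open>The entropy is a lower bound of the quotients at this very \<open>k\<close>,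
      so no passage to the limit is needed.\<close>
    also have "\<dots> \<le> 2 powr log 2 (real (card (language k X)))"
      using topological_entropy_limit(2)[OF assms(2) k] k by (simp add: pos_le_divide_eq)
    also have "\<dots> = real (card (language k X))"
      using card_language_pos[OF assms(2), of k] by simp
    finally show False by simp
  qed
  with \<epsilon> show ?thesis using that by blast
qed

text \<open>The count depends on finitely many coordinates, each with values in a discrete space,
  hence is continuous.\<close>

lemma closedin_nonzero_count_ge:
  "closedin (full_shift_topology n) {\<omega> \<in> full_shift n. nonzero_count k \<omega> \<ge> c}"
proof -
  have "continuous_map (full_shift_topology n) euclideanreal (\<lambda>\<omega>. of_bool (\<omega> i \<noteq> 0))"
    if "i \<in> {1..k}" for i
  proof -
    have "continuous_map (full_shift_topology n) (discrete_topology {0..<n}) (\<lambda>\<omega>. \<omega> i)"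
      unfolding full_shift_topology_def using that by (intro continuous_map_product_projection) auto
    moreover have "continuous_map (discrete_topology {0..<n}) euclideanreal (\<lambda>x. of_bool (x \<noteq> 0))"
      by simp
    ultimately show ?thesis
      by (rule continuous_map_compose[unfolded o_def])
  qed
  then have "continuous_map (full_shift_topology n) euclideanreal (nonzero_count k)"
    unfolding nonzero_count_def[abs_def] by (intro continuous_map_sum) auto
  moreover have "closedin euclideanreal {c..}" by simp
  ultimately have "closedin (full_shift_topology n)
      {\<omega> \<in> topspace (full_shift_topology n). nonzero_count k \<omega> \<in> {c..}}"
    by (rule closedin_continuous_map_preimage)
  then show ?thesis by (simp add: full_shift_topology_def full_shift_def)
qed

text \<open>The hypothesis controls one length per point. Shifting to a good start controls all
  prefixes up to any given length \<open>K\<close>, and compactness removes the bound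
  \<open>K\<close>. Half of the density is lost in finding the start.\<close>

lemma uniformly_dense_point:
  assumes "subshift n X" "\<epsilon> > 0" and dense: "\<And>k. k \<ge> 1 \<Longrightarrow> \<exists>\<omega>\<in>X. nonzero_count k \<omega> \<ge> \<epsilon> * real k"
  obtains \<omega> where "\<omega> \<in> X" "\<And>k. nonzero_count k \<omega> \<ge> \<epsilon> / 2 * real k"
proof -
  define F where "F K = X \<inter> (\<Inter>k\<in>{..K}. {\<omega> \<in> full_shift n. nonzero_count k \<omega> \<ge> \<epsilon> / 2 * real k})"
    for K
  have closed: "closedin (full_shift_topology n) (F K)" for K
    unfolding F_def using assms(1)
    by (intro closedin_Int closedin_INT closedin_nonzero_count_ge) (auto simp: subshift_def)
  have nonempty: "F K \<noteq> {}" for K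
  proof -
    \<comment> \<open>Chosen so that the dense stretch, of length at least
      \<open>\<epsilon> / 2 * N\<close>, is longer than \<open>K\<close>.\<close>
    obtain N where N: "real N > 2 / \<epsilon> * real K" using reals_Archimedean2 by blast
    moreover have "2 / \<epsilon> * real K \<ge> 0" using \<open>\<epsilon> > 0\<close> by simp
    ultimately have "N \<ge> 1" by linarith
    then obtain \<omega> where \<omega>: "\<omega> \<in> X" "nonzero_count N \<omega> \<ge> \<epsilon> * real N" using dense by blast
    obtain j where j: "j \<le> N" "real (N - j) \<ge> \<epsilon> / 2 * real N"
      "\<And>k. k \<le> N - j \<Longrightarrow> nonzero_count (j + k) \<omega> - nonzero_count j \<omega> \<ge> \<epsilon> / 2 * real k"
      using start_of_dense_stretch[of "\<lambda>k. nonzero_count k \<omega>" "\<epsilon> / 2" N] \<omega> \<open>\<epsilon> > 0\<close>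
      by (auto simp: nonzero_count_def)
    have "real K < real (N - j)" using N j(2) \<open>\<epsilon> > 0\<close> by (simp add: field_simps)
    then have "nonzero_count k (\<lambda>i\<in>{1..}. \<omega> (i + j)) \<ge> \<epsilon> / 2 * real k" if "k \<le> K" for k
      unfolding nonzero_count_shift using j(3)[of k] that by linarith
    moreover have "(\<lambda>i\<in>{1..}. \<omega> (i + j)) \<in> X" using subshift_funpow_shift[OF assms(1) \<omega>(1)] .
    moreover have "X \<subseteq> full_shift n" using assms(1) by (simp add: subshift_def)
    ultimately show ?thesis unfolding F_def by blast
  qed
  \<comment> \<open>Tychonoff's theorem for finite discrete factors; the closed sets
    \<open>F K\<close> decrease in \<open>K\<close>, so they have a common point.\<close>
  have "compact_space (full_shift_topology n)"
    by (simp add: full_shift_topology_def compact_space_product_topology compact_space_discrete_topology)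
  then have "(\<Inter>K. F K) \<noteq> {}"
    by (rule compact_space_imp_nest) (use closed nonempty in \<open>auto simp: F_def decseq_def\<close>)
  then obtain \<omega> where \<omega>: "\<And>K. \<omega> \<in> F K" by blast
  then have "\<omega> \<in> X" "\<And>k. nonzero_count k \<omega> \<ge> \<epsilon> / 2 * real k" by (auto simp: F_def)
  then show ?thesis using that by blast
qed

lemma dense_ones_if_topological_entropy_pos:
  assumes "n \<ge> 2" "subshift n X" "hereditary n X" "topological_entropy X > 0"
  shows "\<exists>\<omega>\<in>X. upper_Banach_density {j. 1 \<le> j \<and> \<omega> j = 1} > 0"
proof -
  obtain \<epsilon> where \<epsilon>: "\<epsilon> > 0" "\<And>k. k \<ge> 1 \<Longrightarrow> \<exists>\<omega>\<in>X. nonzero_count k \<omega> \<ge> \<epsilon> * real k"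
    using dense_words_if_topological_entropy_pos[of n X] assms by auto
  then obtain \<omega> where \<omega>: "\<omega> \<in> X" "\<And>k. nonzero_count k \<omega> \<ge> \<epsilon> / 2 * real k"
    using uniformly_dense_point[OF assms(2)] by blast
  \<comment> \<open>Heredity turns density of nonzero letters into density of the letter 1, since
    every nonzero letter is at least 1.\<close>
  define \<omega>' :: "nat \<Rightarrow> nat" where "\<omega>' = (\<lambda>i\<in>{1..}. of_bool (\<omega> i \<noteq> 0))"
  have "\<omega>' \<in> full_shift n" using assms(1) by (auto simp: \<omega>'_def full_shift_def)
  moreover have "\<forall>i\<ge>1. \<omega>' i \<le> \<omega> i" by (auto simp: \<omega>'_def)
  ultimately have "\<omega>' \<in> X" using assms \<omega> by (auto simp: hereditary_def)
  moreover have "real (card ({j. 1 \<le> j \<and> \<omega>' j = 1} \<inter> {1..<1 + k})) \<ge> \<epsilon> / 2 * real k" for k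
  proof -
    have "{j. 1 \<le> j \<and> \<omega>' j = 1} \<inter> {1..<1 + k} = {1..k} \<inter> {j. \<omega> j \<noteq> 0}"
      by (auto simp: \<omega>'_def)
    then have "real (card ({j. 1 \<le> j \<and> \<omega>' j = 1} \<inter> {1..<1 + k})) = nonzero_count k \<omega>"
      by (simp add: nonzero_count_def sum_of_bool_eq)
    with \<omega>(2) show ?thesis by simp
  qed
  \<comment> \<open>Prefixes, the windows with \<open>m = 1\<close>, already suffice as
    witnesses.\<close>
  then have "\<exists>m k. m \<ge> 1 \<and> k \<ge> N \<and> k > 0 \<and>
      real (card ({j. 1 \<le> j \<and> \<omega>' j = 1} \<inter> {m..<m + k})) \<ge> \<epsilon> / 2 * real k" for N
    by (metis le_numeral_extra(4) lessI less_imp_le zero_less_Suc)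
  then have "upper_Banach_density {j. 1 \<le> j \<and> \<omega>' j = 1} > 0"
    unfolding zero_less_upper_Banach_density_iff using \<epsilon>(1) by (intro exI[of _ "\<epsilon> / 2"]) simp
  ultimately show ?thesis by blast
qed

theorem theorem12:
  fixes n :: nat and X :: "(nat \<Rightarrow> nat) set"
  assumes "n \<ge> 2"
    and "subshift n X"
    and "hereditary n X"
  shows "topological_entropy X > 0 \<longleftrightarrow>
    (\<exists>\<omega>\<in>X. upper_Banach_density {j. 1 \<le> j \<and> \<omega> j = 1} > 0)"
  using dense_ones_if_topological_entropy_pos[OF assms]
    topological_entropy_pos_if_dense_ones[OF assms] by blast

end
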